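(* Let $R$ be a ring with $1\neq 0$, let $\Lambda$ be a set, and let $\Delta\subseteq\Lambda\times\Lambda$ satisfy axioms (A1) and (A2). Let $\Gamma_1$ be the set of all isolated elements of $\Delta$. Then the center of $G(\Delta)$ is equal to $G(\Gamma_1)$.
   Context: Rings are associative and unital, not necessarily commutative. For a subset $\Delta\subseteq\Lambda\times\Lambda$ the axioms are: (A1) $(i,i)\notin\Delta$ for all $i\in\Lambda$; (A2) whenever $(i,j),(j,k),(k,\ell),(i,\ell)\in\Delta$, one has $(i,k)\in\Delta\Leftrightarrow(j,\ell)\in\Delta$. $R\Delta$ is the free $R$-module with basis $\{e_{i,j} : (i,j)\in\Delta\}$, made into a (nonunital) ring by $(ae_{i,j})(be_{k,\ell})=ab\,e_{i,\ell}$ if $j=k$ and $(i,\ell)\in\Delta$, and $(ae_{i,j})(be_{k,\ell})=0$ otherwise. Adjoining $1$ gives the ring $R\cdot 1\oplus R\Delta$ (scalars from $R$ commute with the basis elements, i.e. $e_{i,j}\cdot r=r e_{i,j}$), and $G(\Delta)=\{1+x : x\in R\Delta\}$, a subgroup of its unit group. For $\Gamma\subseteq\Delta$, $R\Gamma$ is the $R$-span of the $e_{i,j}$ with $(i,j)\in\Gamma$, and $G(\Gamma)=\{1+x: x\in R\Gamma\}$. An element $(i,j)\in\Delta$ is isolated if there is no $(j,k)\in\Delta$ such that $(i,k)\in\Delta$, and there is no $(\ell,i)\in\Delta$ such that $(\ell,j)\in\Delta$. *)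

theory Defs
  imports "HOL-Algebra.Ring"
begin

definition axiom_A1 :: "'i set \<Rightarrow> ('i \<times> 'i) set \<Rightarrow> bool" where
  "axiom_A1 \<Lambda> \<Delta> \<longleftrightarrow> (\<forall>i\<in>\<Lambda>. (i, i) \<notin> \<Delta>)"

definition axiom_A2 :: "('i \<times> 'i) set \<Rightarrow> bool" where
  "axiom_A2 \<Delta> \<longleftrightarrow>
    (\<forall>i j k l. (i, j) \<in> \<Delta> \<and> (j, k) \<in> \<Delta> \<and> (k, l) \<in> \<Delta> \<and> (i, l) \<in> \<Delta> \<longrightarrow>
      ((i, k) \<in> \<Delta> \<longleftrightarrow> (j, l) \<in> \<Delta>))"

text \<open>
  The free module with basis indexed by \<open>\<Gamma>\<close>: an element is represented by its coefficient
  function, which has finite support and vanishes outside \<open>\<Gamma>\<close>.  For \<open>\<Gamma> \<subseteq> \<Delta>\<close> this is also the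
  span of the corresponding basis elements inside the free module on \<open>\<Delta>\<close>.
\<close>

definition free_span :: "('r, 'm) ring_scheme \<Rightarrow> ('i \<times> 'i) set \<Rightarrow> ('i \<times> 'i \<Rightarrow> 'r) set" where
  "free_span R \<Gamma> =
    {x. (\<forall>p. x p \<in> carrier R) \<and> finite {p. x p \<noteq> \<zero>\<^bsub>R\<^esub>} \<and> (\<forall>p. p \<notin> \<Gamma> \<longrightarrow> x p = \<zero>\<^bsub>R\<^esub>)}"

definition scaled_basis :: "('r, 'm) ring_scheme \<Rightarrow> 'r \<Rightarrow> 'i \<times> 'i \<Rightarrow> ('i \<times> 'i \<Rightarrow> 'r)" where
  "scaled_basis R a p = (\<lambda>q. if q = p then a else \<zero>\<^bsub>R\<^esub>)"

text \<open>
  The biadditive extension of the multiplication rule on the elements \<open>a e\<^sub>i\<^sub>j\<close>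
  (recovered as \<open>delta_mult_scaled_basis\<close> below), written in coefficients.  The index set of the
  sum is restricted to the nonzero terms to make it finite.
\<close>

definition delta_mult ::
  "('r, 'm) ring_scheme \<Rightarrow> ('i \<times> 'i) set \<Rightarrow> ('i \<times> 'i \<Rightarrow> 'r) \<Rightarrow> ('i \<times> 'i \<Rightarrow> 'r) \<Rightarrow> ('i \<times> 'i \<Rightarrow> 'r)" where
  "delta_mult R \<Delta> x y = (\<lambda>(i, l).
     if (i, l) \<in> \<Delta>
     then (\<Oplus>\<^bsub>R\<^esub> j \<in> {j. x (i, j) \<noteq> \<zero>\<^bsub>R\<^esub> \<and> y (j, l) \<noteq> \<zero>\<^bsub>R\<^esub>}. x (i, j) \<otimes>\<^bsub>R\<^esub> y (j, l))
     else \<zero>\<^bsub>R\<^esub>)"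

lemma (in ring) delta_mult_scaled_basis:
  assumes a: "a \<in> carrier R" and b: "b \<in> carrier R"
  shows "delta_mult R \<Delta> (scaled_basis R a (i, j)) (scaled_basis R b (k, l)) =
    (if j = k \<and> (i, l) \<in> \<Delta> then scaled_basis R (a \<otimes> b) (i, l) else (\<lambda>_. \<zero>))"
proof (rule ext, clarify)
  fix p q
  let ?S = "{m. scaled_basis R a (i, j) (p, m) \<noteq> \<zero> \<and> scaled_basis R b (k, l) (m, q) \<noteq> \<zero>}"
  have S: "?S = (if j = k \<and> p = i \<and> q = l \<and> a \<noteq> \<zero> \<and> b \<noteq> \<zero> then {j} else {})"
    by (auto simp: scaled_basis_def)
  have "(\<Oplus>m\<in>?S. scaled_basis R a (i, j) (p, m) \<otimes> scaled_basis R b (k, l) (m, q)) =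
      (if j = k \<and> p = i \<and> q = l then a \<otimes> b else \<zero>)"
    unfolding S using a b
    by (auto simp: scaled_basis_def)
  then have "delta_mult R \<Delta> (scaled_basis R a (i, j)) (scaled_basis R b (k, l)) (p, q) =
      (if (p, q) \<in> \<Delta> then if j = k \<and> p = i \<and> q = l then a \<otimes> b else \<zero> else \<zero>)"
    by (simp only: delta_mult_def prod.case)
  then show "delta_mult R \<Delta> (scaled_basis R a (i, j)) (scaled_basis R b (k, l)) (p, q) =
      (if j = k \<and> (i, l) \<in> \<Delta> then scaled_basis R (a \<otimes> b) (i, l) else (\<lambda>_. \<zero>)) (p, q)"
    by (auto simp: scaled_basis_def)
qed

text \<open>
  The ring \<open>R\<cdot>1 \<oplus> R\<Delta>\<close>; the pair \<open>(r, x)\<close> stands for \<open>r\<cdot>1 + x\<close>.  Since scalars commute with the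
  basis elements, right multiplication by \<open>s\<close> multiplies every coefficient by \<open>s\<close> on the right.
\<close>

definition unital_delta_ring ::
  "('r, 'm) ring_scheme \<Rightarrow> ('i \<times> 'i) set \<Rightarrow> ('r \<times> ('i \<times> 'i \<Rightarrow> 'r)) ring" where
  "unital_delta_ring R \<Delta> =
    \<lparr> carrier = carrier R \<times> free_span R \<Delta>,
      mult = (\<lambda>(r, x) (s, y).
        (r \<otimes>\<^bsub>R\<^esub> s, \<lambda>p. r \<otimes>\<^bsub>R\<^esub> y p \<oplus>\<^bsub>R\<^esub> x p \<otimes>\<^bsub>R\<^esub> s \<oplus>\<^bsub>R\<^esub> delta_mult R \<Delta> x y p)),
      one = (\<one>\<^bsub>R\<^esub>, \<lambda>_. \<zero>\<^bsub>R\<^esub>),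
      zero = (\<zero>\<^bsub>R\<^esub>, \<lambda>_. \<zero>\<^bsub>R\<^esub>),
      add = (\<lambda>(r, x) (s, y). (r \<oplus>\<^bsub>R\<^esub> s, \<lambda>p. x p \<oplus>\<^bsub>R\<^esub> y p)) \<rparr>"

definition G_set ::
  "('r, 'm) ring_scheme \<Rightarrow> ('i \<times> 'i) set \<Rightarrow> ('i \<times> 'i) set \<Rightarrow> ('r \<times> ('i \<times> 'i \<Rightarrow> 'r)) set" where
  "G_set R \<Delta> \<Gamma> =
    {\<one>\<^bsub>unital_delta_ring R \<Delta>\<^esub> \<oplus>\<^bsub>unital_delta_ring R \<Delta>\<^esub> (\<zero>\<^bsub>R\<^esub>, x) | x. x \<in> free_span R \<Gamma>}"

definition G_group ::
  "('r, 'm) ring_scheme \<Rightarrow> ('i \<times> 'i) set \<Rightarrow> ('r \<times> ('i \<times> 'i \<Rightarrow> 'r)) monoid" where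
  "G_group R \<Delta> = (units_of (unital_delta_ring R \<Delta>))\<lparr>carrier := G_set R \<Delta> \<Delta>\<rparr>"

definition center :: "('g, 'n) monoid_scheme \<Rightarrow> 'g set" where
  "center G = {z \<in> carrier G. \<forall>g \<in> carrier G. z \<otimes>\<^bsub>G\<^esub> g = g \<otimes>\<^bsub>G\<^esub> z}"

definition isolated :: "('i \<times> 'i) set \<Rightarrow> 'i \<times> 'i \<Rightarrow> bool" where
  "isolated \<Delta> = (\<lambda>(i, j). (i, j) \<in> \<Delta> \<and>
     \<not> (\<exists>k. (j, k) \<in> \<Delta> \<and> (i, k) \<in> \<Delta>) \<and>
     \<not> (\<exists>l. (l, i) \<in> \<Delta> \<and> (l, j) \<in> \<Delta>))"

end

theory Submission
  imports Defs
begin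

text \<open>
  Two elements \<open>1 + x\<close> and \<open>1 + y\<close> commute iff \<open>xy = yx\<close>.  If \<open>x\<close> is supported on isolated
  pairs, then \<open>xy = 0 = yx\<close> for every \<open>y\<close>.  Conversely, let \<open>x\<close> have a nonzero coefficient at
  \<open>(i, j)\<close>, and suppose that \<open>(j, k)\<close> and \<open>(i, k)\<close> lie in \<open>\<Delta>\<close>.  Then
  \<open>x e\<^sub>j\<^sub>k\<close> has the coefficient \<open>x\<^sub>i\<^sub>j\<close> at \<open>(i, k)\<close>, whereas \<open>e\<^sub>j\<^sub>k x\<close> is supported in row
  \<open>j \<noteq> i\<close>; so \<open>x\<close> is not central.  The other obstruction to being isolated is symmetric.
\<close>

context ring
begin

lemma free_span_closed: "x \<in> free_span R \<Gamma> \<Longrightarrow> x p \<in> carrier R"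
  unfolding free_span_def by blast

lemma free_span_support: "x \<in> free_span R \<Gamma> \<Longrightarrow> x p \<noteq> \<zero> \<Longrightarrow> p \<in> \<Gamma>"
  unfolding free_span_def by blast

lemma scaled_basis_in_free_span:
  assumes "a \<in> carrier R" and "p \<in> \<Gamma>"
  shows "scaled_basis R a p \<in> free_span R \<Gamma>"
proof -
  have "finite {q. scaled_basis R a p q \<noteq> \<zero>}"
    by (rule finite_subset[of _ "{p}"]) (auto simp: scaled_basis_def)
  with assms show ?thesis
    by (auto simp: free_span_def scaled_basis_def)
qed

lemma delta_mult_closed:
  assumes "x \<in> free_span R \<Gamma>" and "y \<in> free_span R \<Gamma>'"
  shows "delta_mult R \<Delta> x y p \<in> carrier R"
  using assms by (cases p) (auto simp: delta_mult_def free_span_closed intro!: finsum_closed)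

lemma delta_mult_unit_right:
  \<comment> \<open>Right multiplication by a basis element moves column \<open>k\<close> of
    \<open>x\<close> to column \<open>l\<close> and truncates the result to \<open>\<Delta>\<close>.
    This lets single coefficients of \<open>x\<close> be read off from products.\<close>
  assumes "x \<in> free_span R \<Gamma>" and "\<one> \<noteq> \<zero>"
  shows "delta_mult R \<Delta> x (scaled_basis R \<one> (k, l)) (i, m) =
    (if (i, m) \<in> \<Delta> \<and> m = l then x (i, k) else \<zero>)"
proof -
  let ?S = "{j. x (i, j) \<noteq> \<zero> \<and> scaled_basis R \<one> (k, l) (j, m) \<noteq> \<zero>}"
  \<comment> \<open>The index set keeps only nonzero factors, so it is empty when
    \<open>x (i, k)\<close> vanishes; the empty sum then still equals
    \<open>x (i, k)\<close>.\<close>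
  have S: "?S =
      (if m = l \<and> x (i, k) \<noteq> \<zero> then {k} else {})"
    using assms by (auto simp: scaled_basis_def)
  have "(\<Oplus>j\<in>?S. x (i, j) \<otimes> scaled_basis R \<one> (k, l) (j, m)) = (if m = l then x (i, k) else \<zero>)"
    unfolding S using free_span_closed[OF assms(1)] by (auto simp: scaled_basis_def)
  then show ?thesis
    by (auto simp only: delta_mult_def prod.case split: if_splits)
qed

lemma delta_mult_unit_left:
  assumes "x \<in> free_span R \<Gamma>" and "\<one> \<noteq> \<zero>"
  shows "delta_mult R \<Delta> (scaled_basis R \<one> (k, l)) x (i, m) =
    (if (i, m) \<in> \<Delta> \<and> i = k then x (l, m) else \<zero>)"
proof -
  let ?S = "{j. scaled_basis R \<one> (k, l) (i, j) \<noteq> \<zero> \<and> x (j, m) \<noteq> \<zero>}"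
  have S: "?S =
      (if i = k \<and> x (l, m) \<noteq> \<zero> then {l} else {})"
    using assms by (auto simp: scaled_basis_def)
  have "(\<Oplus>j\<in>?S. scaled_basis R \<one> (k, l) (i, j) \<otimes> x (j, m)) = (if i = k then x (l, m) else \<zero>)"
    unfolding S using free_span_closed[OF assms(1)] by (auto simp: scaled_basis_def)
  then show ?thesis
    by (auto simp only: delta_mult_def prod.case split: if_splits)
qed

text \<open>A nonzero term at \<open>(i, l)\<close> needs \<open>(i, j)\<close>,
  \<open>(j, l)\<close> and \<open>(i, l)\<close> all in \<open>\<Delta>\<close>. The first clause
  of \<open>isolated\<close> forbids this when \<open>(i, j)\<close> is isolated, the second when
  \<open>(j, l)\<close> is.\<close>

lemma delta_mult_isolated:
  assumes x: "x \<in> free_span R {p. isolated \<Delta> p}" and y: "y \<in> free_span R \<Delta>"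
  shows "delta_mult R \<Delta> x y = (\<lambda>_. \<zero>)" and "delta_mult R \<Delta> y x = (\<lambda>_. \<zero>)"
proof -
  note supp = free_span_support[OF x] free_span_support[OF y]
  have xy: "{j. x (i, j) \<noteq> \<zero> \<and> y (j, l) \<noteq> \<zero>} = {}" if "(i, l) \<in> \<Delta>" for i l
    using that by (fastforce simp: isolated_def dest: supp)
  show "delta_mult R \<Delta> x y = (\<lambda>_. \<zero>)"
    by (rule ext) (simp add: delta_mult_def xy split: prod.split)
  have yx: "{j. y (i, j) \<noteq> \<zero> \<and> x (j, l) \<noteq> \<zero>} = {}" if "(i, l) \<in> \<Delta>" for i l
    using that by (fastforce simp: isolated_def dest: supp)
  show "delta_mult R \<Delta> y x = (\<lambda>_. \<zero>)"
    by (rule ext) (simp add: delta_mult_def yx split: prod.split)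
qed

lemma free_span_isolated_iff:
  assumes irrefl: "\<And>i. (i, i) \<notin> \<Delta>" and nz: "\<one> \<noteq> \<zero>" and x: "x \<in> free_span R \<Delta>"
  shows "x \<in> free_span R {p. isolated \<Delta> p} \<longleftrightarrow>
    (\<forall>y \<in> free_span R \<Delta>. delta_mult R \<Delta> x y = delta_mult R \<Delta> y x)"
proof
  assume "x \<in> free_span R {p. isolated \<Delta> p}"
  then show "\<forall>y \<in> free_span R \<Delta>. delta_mult R \<Delta> x y = delta_mult R \<Delta> y x"
    by (simp add: delta_mult_isolated)
next
  assume comm: "\<forall>y \<in> free_span R \<Delta>. delta_mult R \<Delta> x y = delta_mult R \<Delta> y x"
  \<comment> \<open>Basis elements suffice as test elements, compared one coefficient at a
    time.\<close>
  have unit: "delta_mult R \<Delta> x (scaled_basis R \<one> q) p = delta_mult R \<Delta> (scaled_basis R \<one> q) x p"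
    if "q \<in> \<Delta>" for p q
    using comm that by (simp add: scaled_basis_in_free_span)
  have "isolated \<Delta> (i, j)" if xij: "x (i, j) \<noteq> \<zero>" for i j
  proof -
    have ij: "(i, j) \<in> \<Delta>"
      using x xij by (rule free_span_support)
    then have "i \<noteq> j"
      using irrefl by auto
    have "(i, k) \<notin> \<Delta>" if "(j, k) \<in> \<Delta>" for k
      using unit[OF that, of "(i, k)"] xij \<open>i \<noteq> j\<close> x nz
      by (auto simp: delta_mult_unit_left delta_mult_unit_right)
    \<comment> \<open>If \<open>(l, j)\<close> were in \<open>\<Delta>\<close>, left multiplication
      by the basis element at \<open>(l, i)\<close> would put \<open>x (i, j)\<close> there, while
      right multiplication only reaches column \<open>i\<close>, which differs from
      \<open>j\<close>.\<close>
    moreover have "(l, j) \<notin> \<Delta>" if "(l, i) \<in> \<Delta>" for l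
      using unit[OF that, of "(l, j)"] xij \<open>i \<noteq> j\<close> x nz
      by (auto simp: delta_mult_unit_left delta_mult_unit_right)
    ultimately show ?thesis
      using ij by (auto simp: isolated_def)
  qed
  with x show "x \<in> free_span R {p. isolated \<Delta> p}"
    by (auto simp: free_span_def)
qed

text \<open>With this, the center and \<open>G_set\<close> are both images under
  \<open>Pair \<one>\<close>, and only sets of coefficient functions remain to be compared.\<close>

lemma G_set_eq: "G_set R \<Delta> \<Gamma> = Pair \<one> ` free_span R \<Gamma>"
proof -
  have "\<one>\<^bsub>unital_delta_ring R \<Delta>\<^esub> \<oplus>\<^bsub>unital_delta_ring R \<Delta>\<^esub> (\<zero>, x) = (\<one>, x)"
    if "x \<in> free_span R \<Gamma>" for x
    using free_span_closed[OF that] by (simp add: unital_delta_ring_def)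
  then show ?thesis
    by (force simp: G_set_def)
qed

text \<open>Expanding (1 + x)(1 + y) and (1 + y)(1 + x) gives the same linear part x + y, which
  cancels in the additive group of \<open>R\<close>.\<close>

lemma G_group_commute_iff:
  assumes x: "x \<in> free_span R \<Delta>" and y: "y \<in> free_span R \<Delta>"
  shows "(\<one>, x) \<otimes>\<^bsub>G_group R \<Delta>\<^esub> (\<one>, y) = (\<one>, y) \<otimes>\<^bsub>G_group R \<Delta>\<^esub> (\<one>, x) \<longleftrightarrow>
    delta_mult R \<Delta> x y = delta_mult R \<Delta> y x"
proof -
  have "y p \<oplus> x p \<oplus> delta_mult R \<Delta> x y p = x p \<oplus> y p \<oplus> delta_mult R \<Delta> y x p \<longleftrightarrow>
      delta_mult R \<Delta> x y p = delta_mult R \<Delta> y x p" for p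
    using free_span_closed[OF x] free_span_closed[OF y] delta_mult_closed[OF x y]
      delta_mult_closed[OF y x]
    by (simp add: a_comm[of "y p" "x p"])
  then show ?thesis
    using free_span_closed[OF x] free_span_closed[OF y]
    by (simp add: G_group_def units_of_def unital_delta_ring_def fun_eq_iff)
qed

end

theorem proposition6p1:
  fixes R :: "('r, 'm) ring_scheme"
    and \<Lambda> :: "'i set"
    and \<Delta> :: "('i \<times> 'i) set"
  assumes "ring R"
    and "\<one>\<^bsub>R\<^esub> \<noteq> \<zero>\<^bsub>R\<^esub>"
    and "\<Delta> \<subseteq> \<Lambda> \<times> \<Lambda>"
    and "axiom_A1 \<Lambda> \<Delta>"
    and "axiom_A2 \<Delta>"
  shows "center (G_group R \<Delta>) = G_set R \<Delta> {p. isolated \<Delta> p}"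
proof -
  interpret ring R by fact
  \<comment> \<open>(A1) speaks only of indices in \<open>\<Lambda>\<close>; for any other index,
    \<open>\<Delta> \<subseteq> \<Lambda> \<times> \<Lambda>\<close> excludes the diagonal
    pair.\<close>
  have irrefl: "(i, i) \<notin> \<Delta>" for i
    using assms(3,4) by (auto simp: axiom_A1_def)
  have sub: "free_span R {p. isolated \<Delta> p} \<subseteq> free_span R \<Delta>"
    by (auto simp: free_span_def isolated_def)
  have carrier: "carrier (G_group R \<Delta>) = Pair \<one>\<^bsub>R\<^esub> ` free_span R \<Delta>"
    by (simp add: G_group_def G_set_eq)
  have "center (G_group R \<Delta>) = Pair \<one>\<^bsub>R\<^esub> `
      {x \<in> free_span R \<Delta>. \<forall>y \<in> free_span R \<Delta>. delta_mult R \<Delta> x y = delta_mult R \<Delta> y x}"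
    unfolding center_def carrier by (auto simp: G_group_commute_iff)
  also have "\<dots> = Pair \<one>\<^bsub>R\<^esub> ` free_span R {p. isolated \<Delta> p}"
    using sub free_span_isolated_iff[OF irrefl assms(2)] by (intro arg_cong[of _ _ "image _"]) blast
  finally show ?thesis
    by (simp add: G_set_eq)
qed

end
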